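(* Let $N\ge1$, $\gamma>0$, let $\omega_1,\dots,\omega_N$ be independent Gaussian random variables with mean zero and unit variance, and let $P_{\mathsf{sync}}(\gamma,N)$ denote the probability that the Kuramoto system $\frac{d}{dt}\theta_i=\omega_i+\gamma\sum_{j=1}^N\sin(\theta_j-\theta_i)$, $i=1,\dots,N$, has a fully synchronous solution. Then $$P_{\mathsf{sync}}(\gamma,N)\le\sqrt N\left(\operatorname{erf}\left(\gamma N/\sqrt2\right)\right)^{N-1}.$$
   Context: Let $f_i(\theta)=\sum_{j=1}^N\sin(\theta_j-\theta_i)$ for $\theta\in\mathbb{T}^N=(\mathbb{R}/2\pi\mathbb{Z})^N$. Given $\gamma>0$ and $\omega\in\mathbb{R}^N$, pass to the co-rotating frame, i.e. replace $\omega$ by $\tilde\omega_i=\omega_i-\frac1N\sum_k\omega_k$. The system has a fully synchronous solution if there is $\theta\in\mathbb{T}^N$ with $\gamma f(\theta)=-\tilde\omega$ such that the Jacobian matrix $J(\theta)=(\partial f_i/\partial\theta_j)_{i,j}$ is negative semi-definite with a one-dimensional kernel. Here $\operatorname{erf}(x)=\frac{2}{\sqrt\pi}\int_0^xe^{-t^2}\,dt$. *)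

theory Defs
  imports "HOL-Probability.Probability"
begin

(* The index set {1,...,N} is a finite type 'n with CARD('n) = N. A point of the
   torus (R/2 pi Z)^N is given by a representative in R^N: kuramoto_field and its
   Jacobian are 2 pi-periodic in every coordinate, so existence of a point of the
   torus with a property of these is the same as existence of a representative. *)

definition kuramoto_field :: "real ^ 'n \<Rightarrow> real ^ 'n" where
  "kuramoto_field \<theta> = (\<chi> i. \<Sum>j\<in>UNIV. sin (\<theta> $ j - \<theta> $ i))"

definition corotating :: "real ^ 'n \<Rightarrow> real ^ 'n" where
  "corotating \<omega> = (\<chi> i. \<omega> $ i - (\<Sum>k\<in>UNIV. \<omega> $ k) / real CARD('n))"

definition neg_semidefinite :: "real ^ 'n ^ 'n \<Rightarrow> bool" where
  "neg_semidefinite A \<longleftrightarrow> transpose A = A \<and> (\<forall>v. v \<bullet> (A *v v) \<le> 0)"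

definition matrix_kernel :: "real ^ 'n ^ 'm \<Rightarrow> (real ^ 'n) set" where
  "matrix_kernel A = {v. A *v v = 0}"

definition has_fully_sync_solution :: "real \<Rightarrow> real ^ 'n \<Rightarrow> bool" where
  "has_fully_sync_solution \<gamma> \<omega> \<longleftrightarrow>
     (\<exists>\<theta>. \<gamma> *\<^sub>R kuramoto_field \<theta> = - corotating \<omega> \<and>
          neg_semidefinite (jacobian kuramoto_field (at \<theta>)) \<and>
          dim (matrix_kernel (jacobian kuramoto_field (at \<theta>))) = 1)"

definition sync_event :: "'a measure \<Rightarrow> real \<Rightarrow> ('n::finite \<Rightarrow> 'a \<Rightarrow> real) \<Rightarrow> 'a set" where
  "sync_event M \<gamma> \<omega> = {x \<in> space M. has_fully_sync_solution \<gamma> (\<chi> i. \<omega> i x)}"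

definition erf :: "real \<Rightarrow> real" where
  "erf x = 2 / sqrt pi * (LBINT t=0..x. exp (- t\<^sup>2))"

end

theory Submission
  imports Defs
begin

text \<open>
  A fully synchronous solution forces every coordinate of the centred frequency vector
  to be at most \<open>\<gamma> N\<close> in absolute value, so it suffices to bound the Gaussian measure of the
  box \<open>\<bar>\<omega>\<^sub>i - m\<bar> \<le> \<gamma> N\<close>, where \<open>m\<close> is the mean and \<open>i\<close> runs over all indices but one, \<open>k\<close>. Trade the
  variable \<open>\<omega>\<^sub>k\<close> for \<open>m\<close> (Jacobian \<open>N\<close>) and, for fixed \<open>m\<close>, shift the other variables by \<open>m\<close>.
  With \<open>S\<close> the sum of the shifted variables, the Gaussian weight becomes the standard one in
  these variables times \<open>exp (- N m\<^sup>2 / 2 - S\<^sup>2 / 2)\<close>, up to a constant. Dropping \<open>S\<close> decouples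
  \<open>m\<close>, whose integral contributes the factor \<open>\<surd>N\<close>.

  For measurability, note that the Jacobian annihilates the constant vectors, so its kernel is
  a line iff the Jacobian is bounded below on their orthogonal complement. With an explicit bound
  this is a closed condition on \<open>\<theta>\<close>; hence the admissible phases form a \<open>\<sigma>\<close>-compact set, and
  so do their values under the field.
\<close>

section \<open>Measurability of the synchronization event\<close>

text \<open>With one kernel vector \<open>u\<close> known, a one-dimensional kernel means
  injectivity on the orthogonal complement of \<open>u\<close>, and in finite dimension this is the
  same as a lower bound there. The constant ranges over naturals so that the condition becomes a
  countable union.\<close>

lemma dim_matrix_kernel_eq_1_iff:
  fixes A :: "real ^ 'n ^ 'm"
  assumes u: "A *v u = 0" "u \<noteq> 0"
  shows "dim (matrix_kernel A) = 1 \<longleftrightarrow>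
    (\<exists>n::nat. \<forall>v. v \<bullet> u = 0 \<longrightarrow> norm v \<le> real n * norm (A *v v))"
proof
  have ker: "subspace (matrix_kernel A)"
    by (auto simp: matrix_kernel_def subspace_def matrix_vector_right_distrib matrix_vector_mult_scaleR)
  have sub: "span {u} \<subseteq> matrix_kernel A"
    using u by (intro span_minimal ker) (auto simp: matrix_kernel_def)
  have dim_u: "dim (span {u}) = 1"
    using u by (simp add: dim_span)
  {
    assume "dim (matrix_kernel A) = 1"
    then have ker_eq: "matrix_kernel A = span {u}"
      using subspace_dim_equal[OF subspace_span ker sub] dim_u by simp
    let ?S = "{v. v \<bullet> u = 0}"
    have inj: "v = 0" if v: "v \<in> ?S" "A *v v = 0" for v
    proof -
      have "v \<in> span {u}"
        using ker_eq v by (auto simp: matrix_kernel_def)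
      then obtain c where "v = c *\<^sub>R u"
        by (auto simp: span_singleton)
      with v u show ?thesis by auto
    qed
    have "closed ?S" by (intro closed_Collect_eq continuous_intros)
    moreover have "subspace ?S" by (auto simp: subspace_def inner_add_left)
    ultimately obtain e where e: "e > 0" "\<And>v. v \<in> ?S \<Longrightarrow> e * norm v \<le> norm (A *v v)"
      using injective_imp_isometric[of ?S "(*v) A"] inj by (auto simp: matrix_vector_mul_bounded_linear)
    obtain n :: nat where n: "1 / e < real n" using reals_Archimedean2 by blast
    have "norm v \<le> real n * norm (A *v v)" if "v \<bullet> u = 0" for v
    proof -
      have "norm v \<le> (1 / e) * norm (A *v v)"
        using e that by (simp add: field_simps)
      also have "\<dots> \<le> real n * norm (A *v v)"
        using n by (intro mult_right_mono) auto
      finally show ?thesis .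
    qed
    then show "\<exists>n::nat. \<forall>v. v \<bullet> u = 0 \<longrightarrow> norm v \<le> real n * norm (A *v v)" by blast
  }
  assume "\<exists>n::nat. \<forall>v. v \<bullet> u = 0 \<longrightarrow> norm v \<le> real n * norm (A *v v)"
  then obtain n :: nat where n: "\<And>v. v \<bullet> u = 0 \<Longrightarrow> norm v \<le> real n * norm (A *v v)" by blast
  have "matrix_kernel A \<subseteq> span {u}"
  proof
    fix v assume v: "v \<in> matrix_kernel A"
    \<comment> \<open>The coefficient of the orthogonal projection of \<open>v\<close> onto
      \<open>u\<close>; the remainder is a kernel vector orthogonal to \<open>u\<close>, which the
      bound forces to vanish.\<close>
    define c where "c = (v \<bullet> u) / (u \<bullet> u)"
    have "(v - c *\<^sub>R u) \<bullet> u = 0"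
      using u by (simp add: c_def inner_diff_left)
    moreover have "A *v (v - c *\<^sub>R u) = 0"
      using u v by (simp add: matrix_kernel_def matrix_vector_mult_diff_distrib matrix_vector_mult_scaleR)
    ultimately have "v = c *\<^sub>R u" using n[of "v - c *\<^sub>R u"] by simp
    then show "v \<in> span {u}" by (simp add: span_base span_scale)
  qed
  with sub dim_u show "dim (matrix_kernel A) = 1" by (simp add: subset_antisym)
qed

lemma has_derivative_kuramoto_field:
  fixes \<theta> :: "real ^ 'n"
  shows "(kuramoto_field has_derivative
    (\<lambda>v. \<chi> i. \<Sum>j\<in>UNIV. cos (\<theta> $ j - \<theta> $ i) * (v $ j - v $ i))) (at \<theta>)"
proof (rule has_derivative_componentwise_within[THEN iffD2, rule_format])
  fix b :: "real ^ 'n" assume "b \<in> Basis"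
  then obtain i where b: "b = axis i 1" by (auto simp: Basis_vec_def)
  have "((\<lambda>x. x $ j - x $ i) has_derivative (\<lambda>v. v $ j - v $ i)) (at \<theta>)" for j
    by (intro has_derivative_diff bounded_linear_imp_has_derivative bounded_linear_vec_nth)
  then have "((\<lambda>x. sin (x $ j - x $ i)) has_derivative
      (\<lambda>v. cos (\<theta> $ j - \<theta> $ i) * (v $ j - v $ i))) (at \<theta>)" for j
    by (subst mult.commute) (rule has_derivative_sin)
  then have "((\<lambda>x. \<Sum>j\<in>UNIV. sin (x $ j - x $ i)) has_derivative
      (\<lambda>v. \<Sum>j\<in>UNIV. cos (\<theta> $ j - \<theta> $ i) * (v $ j - v $ i))) (at \<theta>)"
    by (rule has_derivative_sum)
  then show "((\<lambda>x. kuramoto_field x \<bullet> b) has_derivative (\<lambda>v. (\<chi> i. \<Sum>j\<in>UNIV.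
      cos (\<theta> $ j - \<theta> $ i) * (v $ j - v $ i)) \<bullet> b)) (at \<theta>)"
    by (simp add: b inner_axis kuramoto_field_def)
qed

text \<open>The action on a vector, rather than the entries, shows at once that constant vectors are
  annihilated and that the dependence on \<theta> is continuous.\<close>

lemma jacobian_kuramoto_field:
  fixes \<theta> v :: "real ^ 'n"
  shows "jacobian kuramoto_field (at \<theta>) *v v =
    (\<chi> i. \<Sum>j\<in>UNIV. cos (\<theta> $ j - \<theta> $ i) * (v $ j - v $ i))"
proof -
  note * = has_derivative_kuramoto_field[of \<theta>]
  have "(kuramoto_field has_derivative (\<lambda>v. jacobian kuramoto_field (at \<theta>) *v v)) (at \<theta>)"
    using * unfolding jacobian_works[symmetric] by (rule differentiableI)
  from has_derivative_unique[OF this *] show ?thesis by (rule fun_cong)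
qed

text \<open>For fixed indices or a fixed \<open>v\<close>, symmetry and the sign condition compare
  continuous functions of \<theta>, and arbitrary intersections of closed sets are closed. Entries
  are read off from basis vectors so that the explicit action applies.\<close>

lemma closed_neg_semidefinite_jacobian_kuramoto_field:
  "closed {\<theta> :: real ^ 'n. neg_semidefinite (jacobian kuramoto_field (at \<theta>))}"
proof -
  let ?J = "\<lambda>\<theta> :: real ^ 'n. jacobian kuramoto_field (at \<theta>)"
  have eq: "?J \<theta> $ i $ j = (?J \<theta> *v axis j 1) $ i" for \<theta> i j
    by (simp add: matrix_vector_mult_basis column_def)
  have "neg_semidefinite (?J \<theta>) \<longleftrightarrow>
      (\<forall>i j. (?J \<theta> *v axis j 1) $ i = (?J \<theta> *v axis i 1) $ j) \<and> (\<forall>v. v \<bullet> (?J \<theta> *v v) \<le> 0)" for \<theta>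
    unfolding neg_semidefinite_def eq[symmetric] by (simp add: transpose_def vec_eq_iff) metis
  then show ?thesis unfolding jacobian_kuramoto_field
    by (simp only:) (intro closed_Collect_conj closed_Collect_all closed_Collect_eq closed_Collect_le continuous_intros)
qed

lemma borel_has_fully_sync_solution:
  "{\<omega> :: real ^ 'n. has_fully_sync_solution \<gamma> \<omega>} \<in> sets borel"
proof -
  let ?J = "\<lambda>\<theta> :: real ^ 'n. jacobian kuramoto_field (at \<theta>)"
  define C where "C n = {\<theta>. neg_semidefinite (?J \<theta>) \<and> 
     (\<forall>v. v \<bullet> 1 = 0 \<longrightarrow> norm v \<le> real n * norm (?J \<theta> *v v))}" for n
  \<comment> \<open>Cutting with balls makes the phase sets compact, hence also their images; the
    image of a set that is only closed need not be closed.\<close>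
  define K where "K n m = (\<lambda>\<theta>. - (\<gamma> *\<^sub>R kuramoto_field \<theta>)) ` (C n \<inter> cball 0 (real m))" for n m
  have cont: "continuous_on S (\<lambda>\<theta> :: real ^ 'n. - (\<gamma> *\<^sub>R kuramoto_field \<theta>))" for S
    by (intro continuous_on_minus continuous_on_scaleR continuous_on_const
      has_derivative_continuous_on[OF has_derivative_at_withinI[OF has_derivative_kuramoto_field]])
  have "closed (C n)" for n
    unfolding C_def
    by (intro closed_Collect_conj closed_neg_semidefinite_jacobian_kuramoto_field closed_Collect_all closed_Collect_imp open_Collect_const)
      (unfold jacobian_kuramoto_field, intro closed_Collect_le continuous_intros)
  then have "compact (K n m)" for n m
    unfolding K_def by (intro compact_continuous_image cont closed_Int_compact) auto
  moreover have "continuous_on UNIV (corotating :: real ^ 'n \<Rightarrow> _)"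
    unfolding corotating_def[abs_def] by (intro continuous_intros) simp
  ultimately have "closed (corotating -` K n m)" for n m
    by (intro continuous_closed_vimage compact_imp_closed) (auto simp: continuous_on_eq_continuous_at)
  then have "(\<Union>n m. corotating -` K n m) \<in> sets borel"
    by (intro sets.countable_UN) auto
  also have "(\<Union>n m. corotating -` K n m) = {\<omega>. has_fully_sync_solution \<gamma> \<omega>}"
  proof -
    have dim: "dim (matrix_kernel (?J \<theta>)) = 1 \<longleftrightarrow>
       (\<exists>n::nat. \<forall>v. v \<bullet> 1 = 0 \<longrightarrow> norm v \<le> real n * norm (?J \<theta> *v v))" for \<theta>
      by (rule dim_matrix_kernel_eq_1_iff) (simp_all add: jacobian_kuramoto_field vec_eq_iff)
    have mem: "(\<exists>n m. \<theta> \<in> C n \<inter> cball 0 (real m)) \<longleftrightarrow>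
        neg_semidefinite (?J \<theta>) \<and> dim (matrix_kernel (?J \<theta>)) = 1" for \<theta>
    proof -
      have "\<exists>m. norm \<theta> \<le> real m" by (rule real_arch_simple)
      then show ?thesis unfolding dim C_def by simp
    qed
    have "\<omega> \<in> (\<Union>n m. corotating -` K n m) \<longleftrightarrow> has_fully_sync_solution \<gamma> \<omega>" for \<omega>
    proof -
      have "\<omega> \<in> (\<Union>n m. corotating -` K n m) \<longleftrightarrow>
          (\<exists>\<theta>. corotating \<omega> = - (\<gamma> *\<^sub>R kuramoto_field \<theta>) \<and> (\<exists>n m. \<theta> \<in> C n \<inter> cball 0 (real m)))"
        unfolding K_def by blast
      also have "\<dots> \<longleftrightarrow> has_fully_sync_solution \<gamma> \<omega>"
        unfolding mem has_fully_sync_solution_def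
        by (metis minus_minus)
      finally show ?thesis .
    qed
    then show ?thesis by blast
  qed
  finally show ?thesis .
qed

section \<open>The necessary condition on the frequencies\<close>

text \<open>Each component of the field is a sum of N sines, and the equilibrium equation carries
  the resulting bound over to the centred frequencies.\<close>

lemma abs_corotating_le:
  fixes \<omega> :: "real ^ 'n"
  assumes "has_fully_sync_solution \<gamma> \<omega>" "\<gamma> > 0"
  shows "\<bar>corotating \<omega> $ i\<bar> \<le> \<gamma> * real CARD('n)"
proof -
  obtain \<theta> where \<theta>: "corotating \<omega> = - (\<gamma> *\<^sub>R kuramoto_field \<theta>)"
    using assms(1) unfolding has_fully_sync_solution_def by (metis minus_minus)
  have "\<bar>kuramoto_field \<theta> $ i\<bar> \<le> (\<Sum>j\<in>(UNIV :: 'n set). 1)"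
    unfolding kuramoto_field_def vec_lambda_beta by (intro order_trans[OF sum_abs] sum_mono) auto
  with assms(2) show ?thesis by (simp add: \<theta> abs_mult)
qed

section \<open>The error function and Gaussian intervals\<close>

lemma erf_minus: "erf (- x) = - erf x"
proof -
  have "(LBINT t=0..-x. exp (- t\<^sup>2)) = (LBINT t=x..0. exp (- t\<^sup>2))"
    using interval_integral_reflect[of 0 "ereal (-x)" "\<lambda>t. exp (- t\<^sup>2)"] by (simp add: zero_ereal_def)
  also have "\<dots> = - (LBINT t=0..x. exp (- t\<^sup>2))"
    by (rule interval_integral_endpoints_reverse)
  finally show ?thesis by (simp add: erf_def)
qed

lemma has_real_derivative_erf: "(erf has_real_derivative 2 / sqrt pi * exp (- x\<^sup>2)) (at x)"
proof -
  \<comment> \<open>This interval contains the base point 0 and has \<open>x\<close> in its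
    interior, so that the derivative within it is the full derivative.\<close>
  let ?f = "\<lambda>t::real. exp (- t\<^sup>2)" and ?a = "- \<bar>x\<bar> - 1" and ?b = "\<bar>x\<bar> + 1"
  have "((\<lambda>u. LBINT t=ereal 0..u. ?f t) has_vector_derivative ?f x) (at x within {?a..?b})"
    by (rule interval_integral_FTC2) (auto intro!: continuous_intros)
  then have "((\<lambda>u. LBINT t=0..u. ?f t) has_real_derivative ?f x) (at x within {?a<..<?b})"
    unfolding has_real_derivative_iff_has_vector_derivative zero_ereal_def
    by (rule has_vector_derivative_within_subset) auto
  then have "((\<lambda>u. LBINT t=0..u. ?f t) has_real_derivative ?f x) (at x)"
    by (subst (asm) at_within_open) auto
  then show ?thesis
    unfolding erf_def by (rule DERIV_cmult)
qed

lemma erf_nonneg: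
  assumes "0 \<le> x"
  shows "0 \<le> erf x"
proof -
  have "erf 0 \<le> erf x"
    by (rule DERIV_nonneg_imp_nondecreasing[OF assms]) (auto intro!: exI has_real_derivative_erf)
  then show ?thesis using erf_minus[of 0] by simp
qed

text \<open>Half of \<open>erf (x / sqrt 2)\<close> is an antiderivative of the density, and oddness
  merges the two endpoint values.\<close>

lemma emeasure_std_normal_Icc:
  assumes "0 \<le> a"
  shows "emeasure std_normal_distribution {-a..a} = ennreal (erf (a / sqrt 2))"
proof -
  have "emeasure std_normal_distribution {-a..a} = (\<integral>\<^sup>+x. ennreal (std_normal_density x) * indicator {-a..a} x \<partial>lborel)"
    by (simp add: emeasure_density)
  also have "\<dots> = ennreal (erf (a / sqrt 2) / 2 - erf (- a / sqrt 2) / 2)"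
  proof (rule nn_integral_FTC_Icc)
    show "((\<lambda>x. erf (x / sqrt 2) / 2) has_real_derivative std_normal_density x) (at x)" for x
      by (auto intro!: derivative_eq_intros DERIV_chain2[OF has_real_derivative_erf]
        simp: std_normal_density_def power_divide real_sqrt_mult field_simps)
  qed (use assms in auto)
  finally show ?thesis by (simp add: erf_minus)
qed

section \<open>Translation of the product Gaussian measure\<close>

lemma product_prob_space_std_normal: "product_prob_space (\<lambda>_. std_normal_distribution)"
  by (intro product_prob_spaceI prob_space_normal_density) simp

text \<open>The exponential weight is the ratio of the Gaussian densities at \<open>x + m\<close>
  and at \<open>x\<close>, so a translation of Lebesgue measure gives the identity.\<close>

lemma nn_integral_std_normal_shift:
  assumes [measurable]: "f \<in> borel_measurable borel"
  shows "(\<integral>\<^sup>+x. ennreal (exp (- (m * x) - m\<^sup>2 / 2)) * f (x + m) \<partial>std_normal_distribution) = (\<integral>\<^sup>+x. f x \<partial>std_normal_distribution)"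
proof -
  have *: "std_normal_density (m + x) = std_normal_density x * exp (- (m * x) - m\<^sup>2 / 2)" for x
    by (simp add: std_normal_density_def exp_add[symmetric] power2_sum add_divide_distrib diff_divide_distrib)
  have "(\<integral>\<^sup>+x. f x \<partial>std_normal_distribution) = (\<integral>\<^sup>+x. ennreal (std_normal_density x) * f x \<partial>lborel)"
    by (simp add: nn_integral_density)
  also have "\<dots> = (\<integral>\<^sup>+x. ennreal (std_normal_density (m + x)) * f (m + x) \<partial>lborel)"
    by (subst nn_integral_real_affine[where c=1 and t=m]) auto
  also have "\<dots> = (\<integral>\<^sup>+x. ennreal (std_normal_density x) * (ennreal (exp (- (m * x) - m\<^sup>2 / 2)) * f (x + m)) \<partial>lborel)"
    by (intro nn_integral_cong) (simp add: *[unfolded add.commute[of m]] ennreal_mult mult.assoc add.commute[of m])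
  also have "\<dots> = (\<integral>\<^sup>+x. ennreal (exp (- (m * x) - m\<^sup>2 / 2)) * f (x + m) \<partial>std_normal_distribution)"
    by (simp add: nn_integral_density)
  finally show ?thesis by simp
qed

text \<open>On boxes both weight and indicator factor over the coordinates, which reduces the claim
  to the one-dimensional shift; boxes determine the product measure.\<close>

lemma PiM_std_normal_shift:
  assumes I: "finite I"
  shows "distr (density (PiM I (\<lambda>_. std_normal_distribution)) (\<lambda>x. \<Prod>i\<in>I. ennreal (exp (- (m * x i) - m\<^sup>2 / 2))))
    (PiM I (\<lambda>_. std_normal_distribution)) (\<lambda>x. \<lambda>i\<in>I. x i + m) = PiM I (\<lambda>_. std_normal_distribution)"
    (is "distr (density ?P ?h) _ ?T = _")
proof -
  interpret product_prob_space "\<lambda>_. std_normal_distribution" by (rule product_prob_space_std_normal)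
  note [measurable_cong] = sets_PiM_cong[OF refl, of I "\<lambda>_. std_normal_distribution" "\<lambda>_. borel"]
  show ?thesis
  proof (rule PiM_eqI[OF I])
    fix A :: "'a \<Rightarrow> real set" assume A: "\<And>i. i \<in> I \<Longrightarrow> A i \<in> sets std_normal_distribution"
    then have [measurable]: "\<And>i. i \<in> I \<Longrightarrow> A i \<in> sets borel" by simp
    have box: "Pi\<^sub>E I A \<in> sets ?P"
      using I A by (intro sets_PiM_I_finite) auto
    have "emeasure (distr (density ?P ?h) ?P ?T) (Pi\<^sub>E I A)
        = (\<integral>\<^sup>+ x. indicator (Pi\<^sub>E I A) x \<partial>distr (density ?P ?h) ?P ?T)"
      using box by simp
    also have "\<dots> = (\<integral>\<^sup>+ x. indicator (Pi\<^sub>E I A) (?T x) \<partial>density ?P ?h)"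
      by (rule nn_integral_distr) (use box in measurable)
    also have "\<dots> = (\<integral>\<^sup>+ x. ?h x * indicator (Pi\<^sub>E I A) (?T x) \<partial>?P)"
      by (rule nn_integral_density) (use box in measurable)
    also have "\<dots> = (\<integral>\<^sup>+ x. (\<Prod>i\<in>I. ennreal (exp (- (m * x i) - m\<^sup>2 / 2)) * indicator (A i) (x i + m)) \<partial>PiM I (\<lambda>_. std_normal_distribution))"
    proof (intro nn_integral_cong)
      fix x :: "'a \<Rightarrow> real"
      have "(indicator (Pi\<^sub>E I A) (\<lambda>i\<in>I. x i + m) :: ennreal) = (\<Prod>i\<in>I. indicator (A i) (x i + m))"
        using I by (auto simp: indicator_def PiE_iff prod_zero_iff)
      then show "?h x * indicator (Pi\<^sub>E I A) (?T x)
        = (\<Prod>i\<in>I. ennreal (exp (- (m * x i) - m\<^sup>2 / 2)) * indicator (A i) (x i + m))"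
        by (simp add: prod.distrib)
    qed
    also have "\<dots> = (\<Prod>i\<in>I. \<integral>\<^sup>+ x. ennreal (exp (- (m * x) - m\<^sup>2 / 2)) * indicator (A i) (x + m) \<partial>std_normal_distribution)"
      using I by (intro product_nn_integral_prod) auto
    also have "\<dots> = (\<Prod>i\<in>I. emeasure std_normal_distribution (A i))"
      using A by (intro prod.cong refl) (simp add: nn_integral_std_normal_shift[of "indicator (A _)"])
    finally show "emeasure (distr (density ?P ?h) ?P ?T) (Pi\<^sub>E I A) = (\<Prod>i\<in>I. emeasure std_normal_distribution (A i))" .
  qed simp
qed


text \<open>The product of the weights depends on \<open>x\<close> only through the coordinate sum,
  so it can later be merged with a density in that sum.\<close>

lemma nn_integral_PiM_std_normal_shift:
  assumes I: "finite I" and g: "g \<in> borel_measurable (PiM I (\<lambda>_. std_normal_distribution))"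
  shows "(\<integral>\<^sup>+x. g x \<partial>PiM I (\<lambda>_. std_normal_distribution)) =
    (\<integral>\<^sup>+x. ennreal (exp (- (m * (\<Sum>i\<in>I. x i)) - real (card I) * m\<^sup>2 / 2)) * g (\<lambda>i\<in>I. x i + m) \<partial>PiM I (\<lambda>_. std_normal_distribution))"
    (is "_ = (\<integral>\<^sup>+x. ennreal (?h x) * _ \<partial>?P)")
proof -
  note [measurable_cong] = sets_PiM_cong[OF refl, of I "\<lambda>_. std_normal_distribution" "\<lambda>_. borel"]
  let ?f = "\<lambda>x. \<Prod>i\<in>I. ennreal (exp (- (m * x i) - m\<^sup>2 / 2))" and ?T = "\<lambda>x. \<lambda>i\<in>I. x i + m"
  have f: "?f x = ennreal (?h x)" for x
    using I by (simp add: prod_ennreal exp_sum[symmetric] sum_subtractf sum_negf sum_distrib_left)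
  have "(\<integral>\<^sup>+x. g x \<partial>?P) = (\<integral>\<^sup>+x. g x \<partial>distr (density ?P ?f) ?P ?T)"
    by (simp add: PiM_std_normal_shift[OF I])
  also have "\<dots> = (\<integral>\<^sup>+x. g (?T x) \<partial>density ?P ?f)"
    by (rule nn_integral_distr) (use g in measurable)
  also have "\<dots> = (\<integral>\<^sup>+x. ?f x * g (?T x) \<partial>?P)"
    by (rule nn_integral_density) (use g in measurable)
  finally show ?thesis by (simp only: f)
qed

section \<open>The Gaussian measure of the centred box\<close>

lemma emeasure_PiM_std_normal_centered_le:
  fixes I :: "'i set" and a :: real
  assumes I: "finite I" "k \<notin> I" and a: "0 \<le> a"
  defines "n \<equiv> real (card (insert k I))"
  shows "emeasure (PiM (insert k I) (\<lambda>_. std_normal_distribution))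
      {x \<in> space (PiM (insert k I) (\<lambda>_. std_normal_distribution)). \<forall>i\<in>I. \<bar>x i - (\<Sum>j\<in>insert k I. x j) / n\<bar> \<le> a}
    \<le> ennreal (sqrt n * erf (a / sqrt 2) ^ card I)"
proof -
  interpret product_prob_space "\<lambda>_. std_normal_distribution" by (rule product_prob_space_std_normal)
  note [measurable_cong] = sets_PiM_cong[OF refl, of I "\<lambda>_. std_normal_distribution" "\<lambda>_. borel"]
     sets_PiM_cong[OF refl, of "insert k I" "\<lambda>_. std_normal_distribution" "\<lambda>_. borel"]
  let ?P = "PiM I (\<lambda>_. std_normal_distribution)" and ?Q = "PiM (insert k I) (\<lambda>_. std_normal_distribution)"
  let ?b = "indicator {-a..a} :: real \<Rightarrow> ennreal"
  interpret pair_sigma_finite lborel ?P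
    by (intro pair_sigma_finite.intro sigma_finite_lborel P.sigma_finite_measure_axioms)
  have n: "n = real (card I) + 1" "n > 0" using I by (auto simp: n_def)
  have meas: "{x \<in> space ?Q. \<forall>i\<in>I. \<bar>x i - (\<Sum>j\<in>insert k I. x j) / n\<bar> \<le> a} \<in> sets ?Q" (is "?E \<in> _")
    using I by measurable
  have "emeasure ?Q ?E = (\<integral>\<^sup>+x. indicator ?E x \<partial>?Q)"
    using meas by simp
  \<comment> \<open>The indicator is written as a product so that the integral factors once
    \<open>m\<close> is fixed and the coordinates are decoupled.\<close>
  also have "\<dots> = (\<integral>\<^sup>+x. (\<Prod>i\<in>I. ?b (x i - (\<Sum>j\<in>insert k I. x j) / n)) \<partial>?Q)"
  proof (intro nn_integral_cong)
    have "(\<Prod>i\<in>I. ?b (y i)) = (if \<forall>i\<in>I. \<bar>y i\<bar> \<le> a then 1 else 0)" for y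
      using I by (auto simp: abs_le_iff minus_le_iff indicator_def intro!: prod.neutral bexI)
    then show "indicator ?E x = (\<Prod>i\<in>I. ?b (x i - (\<Sum>j\<in>insert k I. x j) / n))" if "x \<in> space ?Q" for x
      using that by simp
  qed
  also have "\<dots> = (\<integral>\<^sup>+x. (\<integral>\<^sup>+y. (\<Prod>i\<in>I. ?b (x i - (y + (\<Sum>j\<in>I. x j)) / n)) \<partial>std_normal_distribution) \<partial>?P)"
  proof (subst product_nn_integral_insert)
    show "(\<integral>\<^sup>+ x. \<integral>\<^sup>+ y. (\<Prod>i\<in>I. ?b ((x(k := y)) i - (\<Sum>j\<in>insert k I. (x(k := y)) j) / n)) \<partial>std_normal_distribution \<partial>?P)
      = (\<integral>\<^sup>+x. (\<integral>\<^sup>+y. (\<Prod>i\<in>I. ?b (x i - (y + (\<Sum>j\<in>I. x j)) / n)) \<partial>std_normal_distribution) \<partial>?P)"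
    proof (intro nn_integral_cong prod.cong refl)
      fix x :: "'i \<Rightarrow> real" and y i assume "i \<in> I"
      moreover have "(\<Sum>j\<in>I. (x(k := y)) j) = (\<Sum>j\<in>I. x j)"
        using I by (intro sum.cong) auto
      ultimately show "?b ((x(k := y)) i - (\<Sum>j\<in>insert k I. (x(k := y)) j) / n) = ?b (x i - (y + (\<Sum>j\<in>I. x j)) / n)"
        using I by auto
    qed
  qed (use I in \<open>auto intro!: borel_measurable_prod_ennreal\<close>)
  \<comment> \<open>With S the sum over \<open>I\<close>, the substitution
    \<open>y = n * m - S\<close> makes \<open>m\<close> the mean of all coordinates; the factor
    \<open>n\<close> is its Jacobian.\<close>
  also have "\<dots> = (\<integral>\<^sup>+x. (\<integral>\<^sup>+m. ennreal (n * std_normal_density (n * m - (\<Sum>j\<in>I. x j))) * (\<Prod>i\<in>I. ?b (x i - m)) \<partial>lborel) \<partial>?P)"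
  proof (intro nn_integral_cong)
    fix x :: "'i \<Rightarrow> real"
    let ?S = "\<Sum>j\<in>I. x j"
    have "(\<integral>\<^sup>+y. (\<Prod>i\<in>I. ?b (x i - (y + ?S) / n)) \<partial>std_normal_distribution)
      = (\<integral>\<^sup>+y. ennreal (std_normal_density y) * (\<Prod>i\<in>I. ?b (x i - (y + ?S) / n)) \<partial>lborel)"
      by (rule nn_integral_density) auto
    also have "\<dots> = ennreal n * (\<integral>\<^sup>+m. ennreal (std_normal_density (- ?S + n * m)) *
        (\<Prod>i\<in>I. ?b (x i - (- ?S + n * m + ?S) / n)) \<partial>lborel)"
      using n by (subst nn_integral_real_affine[where c=n and t="- ?S"]) auto
    also have "\<dots> = (\<integral>\<^sup>+m. ennreal n * (ennreal (std_normal_density (- ?S + n * m)) *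
        (\<Prod>i\<in>I. ?b (x i - (- ?S + n * m + ?S) / n))) \<partial>lborel)"
      by (rule nn_integral_cmult[symmetric]) auto
    also have "\<dots> = (\<integral>\<^sup>+m. ennreal (n * std_normal_density (n * m - ?S)) * (\<Prod>i\<in>I. ?b (x i - m)) \<partial>lborel)"
      using n by (simp add: ennreal_mult mult.assoc)
    finally show "(\<integral>\<^sup>+y. (\<Prod>i\<in>I. ?b (x i - (y + ?S) / n)) \<partial>std_normal_distribution) =
        (\<integral>\<^sup>+m. ennreal (n * std_normal_density (n * m - ?S)) * (\<Prod>i\<in>I. ?b (x i - m)) \<partial>lborel)" .
  qed
  \<comment> \<open>Integrating over \<open>m\<close> last keeps it constant during the shift of the
    other coordinates.\<close>
  also have "\<dots> = (\<integral>\<^sup>+m. (\<integral>\<^sup>+x. ennreal (n * std_normal_density (n * m - (\<Sum>j\<in>I. x j))) * (\<Prod>i\<in>I. ?b (x i - m)) \<partial>?P) \<partial>lborel)"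
    by (rule Fubini') measurable
  also have "\<dots> \<le> (\<integral>\<^sup>+m. ennreal (sqrt n * erf (a / sqrt 2) ^ card I) * ennreal (normal_density 0 (1 / sqrt n) m) \<partial>lborel)"
  proof (intro nn_integral_mono)
    fix m :: real
    let ?g = "\<lambda>x. ennreal (n * std_normal_density (n * m - (\<Sum>j\<in>I. x j))) * (\<Prod>i\<in>I. ?b (x i - m))"
    \<comment> \<open>This is \<open>n / sqrt (2 * pi) * exp (- (n * m\<^sup>2 / 2))\<close>, split
      so that a probability density of variance \<open>1 / n\<close> appears; after integration over
      \<open>m\<close> only \<open>sqrt n\<close> remains.\<close>
    let ?d = "sqrt n * normal_density 0 (1 / sqrt n) m"
    have "(\<integral>\<^sup>+x. ?g x \<partial>?P) = (\<integral>\<^sup>+x. ennreal (exp (- (m * (\<Sum>i\<in>I. x i)) - real (card I) * m\<^sup>2 / 2)) * ?g (\<lambda>i\<in>I. x i + m) \<partial>?P)"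
      by (rule nn_integral_PiM_std_normal_shift[OF I(1)]) measurable
    also have "\<dots> \<le> (\<integral>\<^sup>+x. ennreal ?d * (\<Prod>i\<in>I. ?b (x i)) \<partial>?P)"
    proof (intro nn_integral_mono)
      fix x :: "'i \<Rightarrow> real"
      let ?S = "\<Sum>j\<in>I. x j"
      \<comment> \<open>The shift adds \<open>(n - 1) * m\<close> to the sum over \<open>I\<close>,
        which leaves a single \<open>m\<close>.\<close>
      have sum: "n * m - (\<Sum>j\<in>I. (\<lambda>i\<in>I. x i + m) j) = m - ?S"
        by (simp add: n sum.distrib algebra_simps)
      have prod: "(\<Prod>i\<in>I. ?b ((\<lambda>i\<in>I. x i + m) i - m)) = (\<Prod>i\<in>I. ?b (x i))"
        by (intro prod.cong) auto
      have "exp (- (m * ?S) - real (card I) * m\<^sup>2 / 2) * (n * std_normal_density (m - ?S))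
        = n / sqrt (2 * pi) * exp (- (n * m\<^sup>2 / 2) - ?S\<^sup>2 / 2)"
      proof -
        \<comment> \<open>The mixed terms in \<open>m\<close> and \<open>?S\<close> cancel.\<close>
        have "- (m * ?S) - real (card I) * m\<^sup>2 / 2 + - (m - ?S)\<^sup>2 / 2 = - (n * m\<^sup>2 / 2) - ?S\<^sup>2 / 2"
          by (simp add: n power2_diff field_simps)
        then show ?thesis by (simp add: std_normal_density_def exp_add[symmetric])
      qed
      \<comment> \<open>Here \<open>exp (- ?S\<^sup>2 / 2)\<close> is bounded by 1, the only loss in
        this estimate.\<close>
      also have "\<dots> \<le> n / sqrt (2 * pi) * exp (- (n * m\<^sup>2 / 2))"
        using n by (intro mult_left_mono) auto
      also have "\<dots> = ?d"
        using n(2) by (simp add: normal_density_def power_divide real_sqrt_mult real_sqrt_divide mult.commute[of n])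
      finally have "ennreal (exp (- (m * ?S) - real (card I) * m\<^sup>2 / 2)) * ennreal (n * std_normal_density (m - ?S)) \<le> ennreal ?d"
        using n by (subst ennreal_mult[symmetric]) (auto intro: ennreal_leI)
      then show "ennreal (exp (- (m * ?S) - real (card I) * m\<^sup>2 / 2)) * ?g (\<lambda>i\<in>I. x i + m)
          \<le> ennreal ?d * (\<Prod>i\<in>I. ?b (x i))"
        unfolding sum prod mult.assoc[symmetric] by (rule mult_right_mono) simp
    qed
    also have "\<dots> = ennreal ?d * (\<integral>\<^sup>+x. (\<Prod>i\<in>I. ?b (x i)) \<partial>?P)"
      by (rule nn_integral_cmult) measurable
    also have "(\<integral>\<^sup>+x. (\<Prod>i\<in>I. ?b (x i)) \<partial>?P) = (\<Prod>i\<in>I. emeasure std_normal_distribution {-a..a})"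
      using I by (subst product_nn_integral_prod) auto
    also have "\<dots> = ennreal (erf (a / sqrt 2) ^ card I)"
      using emeasure_std_normal_Icc[OF a] erf_nonneg[of "a / sqrt 2"] a by (simp add: ennreal_power)
    finally show "(\<integral>\<^sup>+x. ?g x \<partial>?P) \<le> ennreal (sqrt n * erf (a / sqrt 2) ^ card I) * ennreal (normal_density 0 (1 / sqrt n) m)"
      using n erf_nonneg[of "a / sqrt 2"] a by (simp add: ennreal_mult[symmetric] ac_simps)
  qed
  also have "\<dots> = ennreal (sqrt n * erf (a / sqrt 2) ^ card I) * (\<integral>\<^sup>+m. ennreal (normal_density 0 (1 / sqrt n) m) \<partial>lborel)"
    by (rule nn_integral_cmult) measurable
  also have "(\<integral>\<^sup>+m. ennreal (normal_density 0 (1 / sqrt n) m) \<partial>lborel) = 1"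
    using n by (simp add: nn_integral_eq_integral)
  finally show ?thesis by simp
qed

section \<open>Transfer to the given probability space\<close>

theorem lemma4p2:
  fixes M :: "'a measure"
    and \<gamma> :: real
    and \<omega> :: "'n::finite \<Rightarrow> 'a \<Rightarrow> real"
  assumes "prob_space M"
    and "\<gamma> > 0"
    and "prob_space.indep_vars M (\<lambda>_. borel) \<omega> UNIV"
    and "\<And>i. distributed M lborel (\<omega> i) std_normal_density"
  shows "sync_event M \<gamma> \<omega> \<in> sets M \<and>
         measure M (sync_event M \<gamma> \<omega>)
           \<le> sqrt (real CARD('n)) * erf (\<gamma> * real CARD('n) / sqrt 2) ^ (CARD('n) - 1)"
proof -
  interpret prob_space M by fact
  have [measurable]: "\<omega> i \<in> borel_measurable M" for i
    using distributed_measurable[OF assms(4)[of i]] by simp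
  have "(\<lambda>x. \<chi> i. \<omega> i x) \<in> borel_measurable M"
    by (subst borel_measurable_euclidean_space) (auto simp: Basis_vec_def inner_axis)
  from measurable_sets[OF this borel_has_fully_sync_solution[of \<gamma>]]
  have sets: "sync_event M \<gamma> \<omega> \<in> sets M"
    by (simp add: sync_event_def vimage_def Int_def conj_commute)
  \<comment> \<open>The choice of \<open>k\<close> is arbitrary; leaving its constraint out of the
    box is what gives the exponent N - 1.\<close>
  obtain k :: 'n where True by simp
  let ?N = "real CARD('n)"
  define I where "I = UNIV - {k}"
  have I: "finite I" "k \<notin> I" "insert k I = UNIV" "card I = CARD('n) - 1"
    by (auto simp: I_def)
  let ?Q = "PiM UNIV (\<lambda>_::'n. std_normal_distribution)"
  let ?a = "\<gamma> * ?N"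
  let ?E = "{x \<in> space ?Q. \<forall>i\<in>I. \<bar>x i - (\<Sum>j\<in>UNIV. x j) / ?N\<bar> \<le> ?a}"
  note [measurable_cong] = sets_PiM_cong[OF refl, of UNIV "\<lambda>_::'n. std_normal_distribution" "\<lambda>_. borel"]
  have "distr M borel (\<omega> i) = std_normal_distribution" for i
    using distributed_distr_eq_density[OF assms(4)[of i]] by (simp cong: distr_cong)
  \<comment> \<open>Independence and the marginals identify the joint law, taken on functions rather
    than on vectors, with the product Gaussian.\<close>
  then have distr: "distr M (PiM UNIV (\<lambda>_. borel)) (\<lambda>x. \<lambda>i\<in>UNIV. \<omega> i x) = ?Q"
    using assms(3) by (subst (asm) indep_vars_iff_distr_eq_PiM) auto
  have "?E \<in> sets ?Q"
    by measurable
  then have E: "?E \<in> sets (PiM UNIV (\<lambda>_. borel))"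
    by (simp cong: sets_PiM_cong)
  have "emeasure M (sync_event M \<gamma> \<omega>) \<le> emeasure M ((\<lambda>x. \<lambda>i\<in>UNIV. \<omega> i x) -` ?E \<inter> space M)"
  proof (rule emeasure_mono)
    show "sync_event M \<gamma> \<omega> \<subseteq> (\<lambda>x. \<lambda>i\<in>UNIV. \<omega> i x) -` ?E \<inter> space M"
      using abs_corotating_le[OF _ assms(2), of "\<chi> i. \<omega> i _"]
      by (auto simp: sync_event_def corotating_def space_PiM)
    show "(\<lambda>x. \<lambda>i\<in>UNIV. \<omega> i x) -` ?E \<inter> space M \<in> events"
      by (rule measurable_sets[OF _ E]) measurable
  qed
  also have "\<dots> = emeasure ?Q ?E"
    unfolding distr[symmetric] by (rule emeasure_distr[symmetric, OF _ E[folded distr]]) measurable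
  also have "\<dots> \<le> ennreal (sqrt ?N * erf (?a / sqrt 2) ^ (CARD('n) - 1))"
    using emeasure_PiM_std_normal_centered_le[OF I(1,2), of ?a] assms(2) I(3,4) by simp
  finally have "measure M (sync_event M \<gamma> \<omega>) \<le> sqrt ?N * erf (?a / sqrt 2) ^ (CARD('n) - 1)"
    using erf_nonneg[of "?a / sqrt 2"] assms(2) by (simp add: emeasure_eq_measure)
  with sets show ?thesis by simp
qed

end
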